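(* Let $\vec{G}$ be an oriented graph of order $n$ such that $\Delta_{\min}(\vec{G}) \leq 1$. Then $\mathcal{D}_2(\vec{G})$ is connected and has diameter exactly $n$.
   Context: An oriented graph is a finite digraph without loops, parallel arcs, or pairs of opposite arcs between the same two vertices; its order is its number of vertices. For a vertex $v$, $d^+(v)$ and $d^-(v)$ denote its out-degree and in-degree, and $\Delta_{\min}(\vec{G})=\max_{v\in V(\vec{G})} \min\{d^+(v),d^-(v)\}$. A $k$-dicolouring of $\vec{G}$ is a function $c:V(\vec{G})\to\{1,\dots,k\}$ such that for each $i$ the set $c^{-1}(i)$ induces a subdigraph with no directed cycle. The $k$-dicolouring graph $\mathcal{D}_k(\vec{G})$ is the undirected graph whose vertices are the $k$-dicolourings of $\vec{G}$ and in which two $k$-dicolourings are adjacent if they differ on the colour of exactly one vertex. *)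

theory Defs
  imports "Graph_Theory.Graph_Theory" "HOL-Library.FuncSet"
begin

text \<open>The locale \<^locale>\<open>digraph\<close> already provides finiteness and excludes loops and parallel arcs.\<close>

locale oriented_graph = digraph G for G :: "('a, 'b) pre_digraph" (structure) +
  assumes no_opposite_arcs: "u \<rightarrow> v \<Longrightarrow> \<not> v \<rightarrow> u"

text \<open>On \<^typ>\<open>nat\<close>, \<^const>\<open>Sup\<close> is the maximum of a nonempty finite set, and 0 for the null graph.\<close>

definition Delta_min :: "('a, 'b) pre_digraph \<Rightarrow> nat" where
  "Delta_min G = (SUP v\<in>verts G. min (out_degree G v) (in_degree G v))"

text \<open>Colourings are extensional, so that two of them are equal iff they agree on all vertices.\<close>

definition dicolouring :: "nat \<Rightarrow> ('a, 'b) pre_digraph \<Rightarrow> ('a \<Rightarrow> nat) \<Rightarrow> bool" where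
  "dicolouring k G c \<longleftrightarrow> c \<in> verts G \<rightarrow>\<^sub>E {1..k} \<and>
     (\<forall>i\<in>{1..k}. \<not> (\<exists>p. pre_digraph.cycle (G \<restriction> {v \<in> verts G. c v = i}) p))"

text \<open>An undirected graph is a symmetric digraph, see \<^locale>\<open>graph\<close>.\<close>

definition dicolouring_graph ::
  "nat \<Rightarrow> ('a, 'b) pre_digraph \<Rightarrow> ('a \<Rightarrow> nat, ('a \<Rightarrow> nat) \<times> ('a \<Rightarrow> nat)) pre_digraph" where
  "dicolouring_graph k G = with_proj
     \<lparr> pverts = {c. dicolouring k G c},
       parcs = {(c, d). dicolouring k G c \<and> dicolouring k G d \<and>
                        (\<exists>!v. v \<in> verts G \<and> c v \<noteq> d v)} \<rparr>"

text \<open>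
  With unit weights, \<^const>\<open>wf_digraph.\<mu>\<close> is the length of a shortest walk, and \<open>\<infinity>\<close> if there
  is none (see \<open>\<mu>_unit_weights\<close>). The value for the null graph is \<open>-\<infinity>\<close>.
\<close>

definition graph_diameter :: "('a, 'b) pre_digraph \<Rightarrow> ereal" where
  "graph_diameter H = (SUP u\<in>verts H. SUP v\<in>verts H. wf_digraph.\<mu> H (\<lambda>_. 1) u v)"

lemma (in wf_digraph) \<mu>_unit_weights:
  "\<mu> (\<lambda>_. 1) u v = (INF p\<in>{p. awalk u p v}. ereal (real (length p)))"
proof -
  have "awalk_cost (\<lambda>_. 1) p = real (length p)" for p
    by (induction p) auto
  then show ?thesis by (simp add: \<mu>_def)
qed

lemma (in fin_digraph) graph_dicolouring_graph: "graph (dicolouring_graph k G)"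
proof -
  let ?V = "{c. dicolouring k G c}"
  have fin: "finite ?V"
    by (rule finite_subset[OF _ finite_PiE[of "verts G" "\<lambda>_. {1..k}"]])
       (auto simp: dicolouring_def)
  have "finite {(c, d). dicolouring k G c \<and> dicolouring k G d \<and>
                        (\<exists>!v. v \<in> verts G \<and> c v \<noteq> d v)}"
    by (rule finite_subset[OF _ finite_cartesian_product[OF fin fin]]) auto
  with fin show ?thesis
    by unfold_locales
       (auto simp: dicolouring_graph_def arc_to_ends_def symmetric_def sym_def eq_commute)
qed

end

theory Submission
  imports Defs
begin

text \<open>
  Dicolourings depend only on the family of vertex sets of directed cycles: a colouring is a
  dicolouring iff none of these sets is monochromatic. Call two vertices twins if they lie on the
  same directed cycles; this is an equivalence relation. If \<^prop>\<open>Delta_min G \<le> 1\<close>, every directed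
  cycle contains two distinct twins (\<open>cycle_set_contains_twins\<close>): either some arc of the cycle is the
  only arc out of its tail and the only arc into its head, and every cycle through one end then
  uses it, or all vertices of the cycle have out-degree one, or all have in-degree one, and every
  cycle that meets this one then contains all of it. Choosing one pair in each class with at
  least two elements gives disjoint pairs such that every cycle contains a pair and no cycle splits
  one (\<open>ex_paired_hypergraph\<close>). Thus every colouring that gives both colours to each pair is a
  dicolouring, whatever the colours of the unpaired vertices.

  Two dicolourings \<open>a\<close> and \<open>b\<close> are joined through a meeting point \<open>c\<close> of this kind that is moreover
  constant on the unpaired vertices. On a pair, \<open>c\<close> copies \<open>a\<close> or \<open>b\<close> if one of them uses both
  colours, and is arbitrary otherwise; either way the pair costs at most two recolourings in total.
  An unpaired vertex costs two in total over the two possible constants, so that one of the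
  constants costs at most one per unpaired vertex on average. Together this gives at most \<open>n\<close>
  recolourings (\<open>exists_meeting_point\<close>), provided that each of \<open>a\<close>, \<open>b\<close> can be turned into \<open>c\<close> by
  recolouring only the vertices on which they differ, once each. This is possible
  (\<open>exists_recolouring_towards\<close>): first break up the monochromatic pairs, then recolour the
  unpaired vertices to their constant colour \<open>i\<close>, and finally exchange the colours within pairs one
  pair at a time, passing through the state in which the pair has the colour other than \<open>i\<close>. A
  monochromatic cycle in that state could contain neither an unpaired vertex nor another pair,
  and so would have only two vertices.

  Conversely, exchanging the two colours in a dicolouring gives a dicolouring that differs from it
  on all \<open>n\<close> vertices, and a step of a walk changes only one vertex.
\<close>

section \<open>Two-colouring a hypergraph with unsplit pairs\<close>

definition monochromatic :: "('a \<Rightarrow> nat) \<Rightarrow> 'a set \<Rightarrow> bool" where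
  "monochromatic c S \<longleftrightarrow> (\<forall>x\<in>S. \<forall>y\<in>S. c x = c y)"

lemma monochromatic_doubleton [simp]: "monochromatic c {x, y} \<longleftrightarrow> c x = c y"
  by (auto simp: monochromatic_def)

lemma monochromatic_subset: "monochromatic c S \<Longrightarrow> T \<subseteq> S \<Longrightarrow> monochromatic c T"
  unfolding monochromatic_def by blast

lemma monochromatic_cong: "(\<And>v. v \<in> S \<Longrightarrow> c v = d v) \<Longrightarrow> monochromatic c S \<longleftrightarrow> monochromatic d S"
  unfolding monochromatic_def by simp

lemma monochromatic_fun_upd: "v \<notin> S \<Longrightarrow> monochromatic (c(v := i)) S \<longleftrightarrow> monochromatic c S"
  by (intro monochromatic_cong) auto

definition disagreement :: "'a set \<Rightarrow> ('a \<Rightarrow> nat) \<Rightarrow> ('a \<Rightarrow> nat) \<Rightarrow> 'a set" where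
  "disagreement V c d = {v \<in> V. c v \<noteq> d v}"

text \<open>
  The edges of \<^term>\<open>H\<close> stand for the vertex sets of directed cycles, those of \<^term>\<open>M\<close> for chosen
  pairs of twins. For oriented graphs, \<open>edge_not_in_pair\<close> is the absence of loops and of directed
  cycles of length two.
\<close>

locale paired_hypergraph =
  fixes V :: "'a set" and H :: "'a set set" and M :: "'a set set"
  assumes finite_vertices: "finite V"
    and pair_subset: "e \<in> M \<Longrightarrow> e \<subseteq> V"
    and card_pair: "e \<in> M \<Longrightarrow> card e = 2"
    and pairs_disjoint: "e \<in> M \<Longrightarrow> f \<in> M \<Longrightarrow> e \<noteq> f \<Longrightarrow> e \<inter> f = {}"
    and pair_unsplit: "C \<in> H \<Longrightarrow> e \<in> M \<Longrightarrow> e \<inter> C \<noteq> {} \<Longrightarrow> e \<subseteq> C"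
    and edge_contains_pair: "C \<in> H \<Longrightarrow> \<exists>e\<in>M. e \<subseteq> C"
    and edge_not_in_pair: "C \<in> H \<Longrightarrow> e \<in> M \<Longrightarrow> \<not> C \<subseteq> e"
    and edge_subset: "C \<in> H \<Longrightarrow> C \<subseteq> V"
begin

definition proper :: "('a \<Rightarrow> nat) \<Rightarrow> bool" where
  "proper c \<longleftrightarrow> c \<in> V \<rightarrow>\<^sub>E {1..2} \<and> (\<forall>C\<in>H. \<not> monochromatic c C)"

definition separating :: "('a \<Rightarrow> nat) \<Rightarrow> bool" where
  "separating c \<longleftrightarrow> c \<in> V \<rightarrow>\<^sub>E {1..2} \<and> (\<forall>e\<in>M. \<not> monochromatic c e)"

lemma separating_imp_proper: "separating c \<Longrightarrow> proper c"
  unfolding separating_def proper_def using edge_contains_pair monochromatic_subset by metis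

lemma fun_upd_colouring:
  assumes "c \<in> V \<rightarrow>\<^sub>E {1..2}" "d \<in> V \<rightarrow>\<^sub>E {1..2}" "v \<in> V"
  shows "c(v := d v) \<in> V \<rightarrow>\<^sub>E {1..2}"
  using assms by (auto simp: PiE_iff extensional_def)

text \<open>
  Iterating this lemma leads from \<^term>\<open>c\<close> to \<^term>\<open>d\<close> by a shortest walk. A monochromatic pair, if there
  is one, must be broken up first, since only a colouring that separates all pairs can be changed
  freely at the unpaired vertices. An exchange within a pair makes the pair monochromatic, and it is
  the next application that completes the exchange.
\<close>

lemma exists_recolouring_towards:
  assumes "proper c" and "separating d"
    and const: "\<forall>v\<in>V - \<Union>M. d v = i"
    and "disagreement V c d \<noteq> {}"
  shows "\<exists>v\<in>disagreement V c d. proper (c(v := d v))"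
proof -
  have c: "c \<in> V \<rightarrow>\<^sub>E {1..2}" and cH: "\<And>C. C \<in> H \<Longrightarrow> \<not> monochromatic c C"
    using \<open>proper c\<close> by (auto simp: proper_def)
  have d: "d \<in> V \<rightarrow>\<^sub>E {1..2}" and dM: "\<And>e. e \<in> M \<Longrightarrow> \<not> monochromatic d e"
    using \<open>separating d\<close> by (auto simp: separating_def)
  have two: "c x = 1 \<or> c x = 2" "d x = 1 \<or> d x = 2" if "x \<in> V" for x
    using c d that by (force simp: PiE_iff)+
  consider (mono) e where "e \<in> M" "monochromatic c e"
    | (unpaired) w where "separating c" "w \<in> V - \<Union>M" "c w \<noteq> d w"
    | (paired) "separating c" "\<And>w. w \<in> V - \<Union>M \<Longrightarrow> c w = d w"
    using c unfolding separating_def by blast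
  then show ?thesis
  proof cases
    case mono
    obtain x y where e: "e = {x, y}" "x \<noteq> y" using card_pair[OF mono(1)] by (auto simp: card_2_iff)
    have V: "x \<in> V" "y \<in> V" using pair_subset[OF mono(1)] e by auto
    have "c x = c y" "d x \<noteq> d y" using mono dM[OF mono(1)] e by auto
    then obtain v where v: "v \<in> e" "c v \<noteq> d v" "d v \<in> {1..2}" "\<not> monochromatic (c(v := d v)) e"
    proof (cases "c x = d x")
      case True
      then have "c y \<noteq> d y" using \<open>c x = c y\<close> \<open>d x \<noteq> d y\<close> by simp
      then show ?thesis using that[of y] e two[OF V(2)] \<open>c x = c y\<close> by auto
    next
      case False
      then show ?thesis using that[of x] e two[OF V(1)] \<open>c x = c y\<close> by auto
    qed
    have "\<not> monochromatic (c(v := d v)) C" if "C \<in> H" for C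
    proof (cases "v \<in> C")
      case True
      then have "e \<subseteq> C" using pair_unsplit[OF that mono(1)] v(1) by auto
      then show ?thesis using v(4) monochromatic_subset by metis
    next
      case False
      then show ?thesis using cH[OF that] by (simp add: monochromatic_fun_upd)
    qed
    moreover have "v \<in> V" using v(1) V e by auto
    ultimately show ?thesis using v(2) fun_upd_colouring[OF c d]
      by (auto simp: proper_def disagreement_def)
  next
    case unpaired
    have "monochromatic (c(w := d w)) e \<longleftrightarrow> monochromatic c e" if "e \<in> M" for e
      using unpaired(2) that by (intro monochromatic_fun_upd) auto
    then have "separating (c(w := d w))"
      using unpaired(1,2) fun_upd_colouring[OF c d] by (auto simp: separating_def)
    then show ?thesis using unpaired(2,3) separating_imp_proper by (auto simp: disagreement_def)
  next
    case paired
    obtain u where "u \<in> V" "c u \<noteq> d u" using assms(4) by (auto simp: disagreement_def)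
    then obtain e where e: "e \<in> M" "u \<in> e" using paired(2) by auto
    obtain x y where xy: "e = {x, y}" "x \<noteq> y" using card_pair[OF e(1)] by (auto simp: card_2_iff)
    have V: "x \<in> V" "y \<in> V" using pair_subset[OF e(1)] xy by auto
    have cd: "c x \<noteq> c y" "d x \<noteq> d y"
      using paired(1) e(1) dM[OF e(1)] unfolding separating_def xy(1) by auto
    \<comment> \<open>The vertex to move first is one whose target is not the colour \<^term>\<open>i\<close> of the unpaired vertices.\<close>
    then obtain v where v: "v \<in> e" "c v \<noteq> d v" "d v \<noteq> i"
    proof (cases "d x = i")
      case True
      then have "d y \<noteq> i" "c y \<noteq> d y"
        using cd e(2) xy \<open>c u \<noteq> d u\<close> two[OF V(1)] two[OF V(2)] by auto
      then show ?thesis using that[of y] xy by simp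
    next
      case False
      moreover have "c x \<noteq> d x"
        using cd e(2) xy \<open>c u \<noteq> d u\<close> two[OF V(1)] two[OF V(2)] by auto
      ultimately show ?thesis using that[of x] xy by simp
    qed
    have vV: "v \<in> V" using v(1) V xy by auto
    let ?c = "c(v := d v)"
    have "\<not> monochromatic ?c C" if C: "C \<in> H" for C
    proof
      assume mono: "monochromatic ?c C"
      have only_e: "f = e" if "f \<in> M" "f \<subseteq> C" for f
      proof (rule ccontr)
        assume "f \<noteq> e"
        then have "v \<notin> f" using pairs_disjoint[OF that(1) e(1)] v(1) by auto
        then have "monochromatic c f"
          using monochromatic_subset[OF mono that(2)] by (simp add: monochromatic_fun_upd)
        then show False using paired(1) that(1) by (auto simp: separating_def)
      qed
      then have "v \<in> C" using edge_contains_pair[OF C] v(1) by auto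
      \<comment> \<open>A vertex of \<^term>\<open>C\<close> outside the pair can only be unpaired, and the colour of the pair is now not \<^term>\<open>i\<close>.\<close>
      obtain z where z: "z \<in> C" "z \<notin> e" using edge_not_in_pair[OF C e(1)] by auto
      have "z \<notin> \<Union>M" using z only_e pair_unsplit[OF C] by blast
      then have "c z = i" using paired(2) const z(1) edge_subset[OF C] by auto
      moreover have "?c z = ?c v" using mono z(1) \<open>v \<in> C\<close> unfolding monochromatic_def by blast
      ultimately show False using v z(2) by (auto split: if_splits)
    qed
    then show ?thesis using v(2) vV fun_upd_colouring[OF c d]
      by (auto simp: proper_def disagreement_def)
  qed
qed

lemma card_disagreement: "card (disagreement V c d) = (\<Sum>v\<in>V. of_bool (c v \<noteq> d v))"
  using finite_vertices by (simp add: disagreement_def Int_def)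

text \<open>
  If neither colouring separates the pair, every separating colouring of it differs from each of
  them on exactly one vertex. Otherwise one of them can be kept, and the other one differs from it
  on at most two vertices.
\<close>

lemma pair_meeting_point:
  fixes a b :: "'a \<Rightarrow> nat"
  assumes "e \<in> M" and "a \<in> V \<rightarrow>\<^sub>E {1..2}" and "b \<in> V \<rightarrow>\<^sub>E {1..2}"
  shows "\<exists>g. g \<in> e \<rightarrow> {1..2} \<and> \<not> monochromatic g e \<and>
    (\<Sum>v\<in>e. of_bool (a v \<noteq> g v) + of_bool (g v \<noteq> b v)) \<le> (2::nat)"
proof -
  obtain x y where xy: "e = {x, y}" "x \<noteq> y" using card_pair[OF assms(1)] by (auto simp: card_2_iff)
  have V: "x \<in> V" "y \<in> V" using pair_subset[OF assms(1)] xy by auto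
  have two: "a x = 1 \<or> a x = 2" "a y = 1 \<or> a y = 2" "b x = 1 \<or> b x = 2" "b y = 1 \<or> b y = 2"
    using assms V by (force simp: PiE_iff)+
  consider "a x \<noteq> a y" | "b x \<noteq> b y" | "a x = a y" "b x = b y" by blast
  then show ?thesis
  proof cases
    case 1
    then show ?thesis using xy two by (intro exI[of _ a]) auto
  next
    case 2
    then show ?thesis using xy two by (intro exI[of _ b]) auto
  next
    case 3
    then show ?thesis using xy two by (intro exI[of _ "\<lambda>v. if v = x then 1 else 2"]) auto
  qed
qed

text \<open>
  Over the two constants, an unpaired vertex has exactly two disagreements with \<^term>\<open>a\<close> and \<^term>\<open>b\<close>
  taken together, so the better constant has at most as many disagreements as there are unpaired
  vertices. The pairs are disjoint, so their colours can be chosen independently.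
\<close>

lemma exists_meeting_point:
  assumes a: "a \<in> V \<rightarrow>\<^sub>E {1..2}" and b: "b \<in> V \<rightarrow>\<^sub>E {1..2}"
  obtains c i where "separating c" "\<forall>v\<in>V - \<Union>M. c v = i"
    "card (disagreement V a c) + card (disagreement V c b) \<le> card V"
proof -
  let ?W = "V - \<Union>M"
  let ?good = "\<lambda>e g. g \<in> e \<rightarrow> {1..2} \<and> \<not> monochromatic g e \<and>
    (\<Sum>v\<in>e. of_bool (a v \<noteq> g v) + of_bool (g v \<noteq> b v)) \<le> (2::nat)"
  have "\<forall>e\<in>M. \<exists>g. ?good e g"
    using pair_meeting_point[OF _ a b] by blast
  then obtain g where "\<forall>e\<in>M. ?good e (g e)"
    using bchoice[of M ?good] by blast
  then have g: "g e \<in> e \<rightarrow> {1..2}" "\<not> monochromatic (g e) e"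
    "(\<Sum>v\<in>e. of_bool (a v \<noteq> g e v) + of_bool (g e v \<noteq> b v)) \<le> (2::nat)" if "e \<in> M" for e
    using that by blast+
  let ?cost = "\<lambda>i. \<Sum>v\<in>?W. of_bool (a v \<noteq> i) + of_bool (i \<noteq> b v) :: nat"
  have "?cost 1 + ?cost 2 = (\<Sum>v\<in>?W. 2)"
    unfolding sum.distrib[symmetric]
  proof (rule sum.cong)
    fix v assume "v \<in> ?W"
    then have "a v = 1 \<or> a v = 2" "b v = 1 \<or> b v = 2" using a b by (force simp: PiE_iff)+
    then show "of_bool (a v \<noteq> 1) + of_bool (1 \<noteq> b v) + (of_bool (a v \<noteq> 2) + of_bool (2 \<noteq> b v)) = (2::nat)"
      by auto
  qed simp
  then have "?cost 1 + ?cost 2 = 2 * card ?W" by (simp only: sum_constant of_nat_id mult.commute)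
  then have "?cost 1 \<le> card ?W \<or> ?cost 2 \<le> card ?W" by linarith
  then have "\<exists>i\<in>{1, 2}. ?cost i \<le> card ?W" by blast
  then obtain i where i: "i \<in> {1..2}" "?cost i \<le> card ?W" by (elim bexE) (rule that, auto)
  define c where "c v = (if v \<in> V then if v \<in> \<Union>M then g (THE e. e \<in> M \<and> v \<in> e) v else i else undefined)" for v
  have cg: "c v = g e v" if "e \<in> M" "v \<in> e" for e v
  proof -
    have "(THE e. e \<in> M \<and> v \<in> e) = e"
      using that pairs_disjoint by (intro the_equality) auto
    then show ?thesis using that pair_subset[OF that(1)] by (auto simp: c_def)
  qed
  have ci: "c v = i" if "v \<in> ?W" for v using that by (simp add: c_def)
  have "c v \<in> {1..2}" if "v \<in> V" for v
  proof (cases "v \<in> \<Union>M")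
    case True
    then obtain e where "e \<in> M" "v \<in> e" by blast
    then show ?thesis using g(1)[of e] cg[of e v] by (auto simp: Pi_iff)
  next
    case False
    then show ?thesis using ci[of v] i that by simp
  qed
  then have "c \<in> V \<rightarrow>\<^sub>E {1..2}" by (auto simp: PiE_iff extensional_def c_def)
  moreover have "\<not> monochromatic c e" if "e \<in> M" for e
    using g(2)[OF that] monochromatic_cong[of e c "g e"] cg[OF that] by auto
  ultimately have sep: "separating c" by (simp add: separating_def)
  have fin: "finite e" if "e \<in> M" for e using card_pair[OF that] card.infinite by fastforce
  let ?f = "\<lambda>v. of_bool (a v \<noteq> c v) + of_bool (c v \<noteq> b v) :: nat"
  have sub: "\<Union>M \<subseteq> V" using pair_subset by blast
  have "sum ?f (\<Union>M) = (\<Sum>e\<in>M. sum ?f e)"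
    using sum.Union_disjoint[of M ?f] fin pairs_disjoint by simp
  also have "\<dots> \<le> (\<Sum>e\<in>M. card e)"
  proof (rule sum_mono)
    fix e assume e: "e \<in> M"
    have "sum ?f e = (\<Sum>v\<in>e. of_bool (a v \<noteq> g e v) + of_bool (g e v \<noteq> b v))"
      using cg[OF e] by (intro sum.cong) auto
    then show "sum ?f e \<le> card e" using g(3)[OF e] card_pair[OF e] by simp
  qed
  also have "\<dots> = card (\<Union>M)"
    using fin pairs_disjoint by (intro card_Union_disjoint[symmetric]) (auto simp: pairwise_def disjnt_def)
  finally have paired: "sum ?f (\<Union>M) \<le> card (\<Union>M)" .
  have "sum ?f ?W = ?cost i" using ci by (intro sum.cong) auto
  then have unpaired: "sum ?f ?W \<le> card ?W" using i(2) by simp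
  have "card (disagreement V a c) + card (disagreement V c b) = sum ?f V"
    by (simp add: card_disagreement sum.distrib)
  also have "\<dots> = sum ?f ?W + sum ?f (\<Union>M)"
    using sum.subset_diff[OF sub finite_vertices] .
  also have "\<dots> \<le> card ?W + card (\<Union>M)"
    using add_mono[OF unpaired paired] .
  also have "\<dots> = card V"
    using card_Diff_subset[OF finite_subset[OF sub finite_vertices] sub] card_mono[OF finite_vertices sub] by simp
  finally show thesis using that sep ci by blast
qed

lemma exists_proper: "\<exists>c. proper c"
proof -
  have *: "(\<lambda>v\<in>V. 1) \<in> V \<rightarrow>\<^sub>E {1..2::nat}" by auto
  obtain c where "separating c" by (rule exists_meeting_point[OF * *])
  then show ?thesis using separating_imp_proper by blast
qed

end

text \<open>
  Belonging to the same edges is an equivalence relation, so pairs that are chosen from different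
  classes are disjoint, and an edge that meets a class contains all of it.
\<close>

lemma ex_paired_hypergraph:
  assumes fin: "finite V"
    and sub: "\<And>C. C \<in> H \<Longrightarrow> C \<subseteq> V"
    and large: "\<And>C. C \<in> H \<Longrightarrow> 2 < card C"
    and twins: "\<And>C. C \<in> H \<Longrightarrow> \<exists>x\<in>C. \<exists>y\<in>C. x \<noteq> y \<and> (\<forall>D\<in>H. x \<in> D \<longleftrightarrow> y \<in> D)"
  shows "\<exists>M. paired_hypergraph V H M"
proof -
  define K where "K v = {u \<in> V. \<forall>D\<in>H. u \<in> D \<longleftrightarrow> v \<in> D}" for v
  define P :: "'a set \<Rightarrow> 'a set" where "P S = (SOME e. e \<subseteq> S \<and> card e = 2)" for S
  let ?M = "P ` {S \<in> K ` V. 2 \<le> card S}"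
  have P: "P S \<subseteq> S \<and> card (P S) = 2" if large: "2 \<le> card S" for S
  proof -
    obtain e where "e \<subseteq> S \<and> card e = 2" using obtain_subset_with_card_n[OF large] by blast
    then show ?thesis unfolding P_def by (rule someI)
  qed
  have "paired_hypergraph V H ?M"
  proof
    show "e \<subseteq> V" if "e \<in> ?M" for e using that P by (auto simp: K_def)
    show "card e = 2" if "e \<in> ?M" for e using that P by auto
    show "e \<inter> f = {}" if ef: "e \<in> ?M" "f \<in> ?M" "e \<noteq> f" for e f
    proof (rule ccontr)
      obtain u v where e: "e = P (K u)" "2 \<le> card (K u)" and f: "f = P (K v)" "2 \<le> card (K v)"
        using ef by blast
      assume "e \<inter> f \<noteq> {}"
      then obtain w where "w \<in> K u" "w \<in> K v" using P[OF e(2)] P[OF f(2)] e f by auto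
      then have "K u = K v" by (auto simp: K_def)
      then show False using e f ef(3) by simp
    qed
    show "e \<subseteq> C" if Ce: "C \<in> H" "e \<in> ?M" "e \<inter> C \<noteq> {}" for C e
    proof -
      obtain u where e: "e = P (K u)" "2 \<le> card (K u)" using Ce(2) by blast
      then have "e \<subseteq> K u" using P by blast
      then show ?thesis using Ce(1,3) unfolding K_def by blast
    qed
    show "\<exists>e\<in>?M. e \<subseteq> C" if C: "C \<in> H" for C
    proof -
      obtain x y where xy: "x \<in> C" "y \<in> C" "x \<noteq> y" "\<forall>D\<in>H. x \<in> D \<longleftrightarrow> y \<in> D"
        using twins[OF C] by blast
      have "{x, y} \<subseteq> K x" using xy sub[OF C] by (auto simp: K_def)
      moreover have "finite (K x)" using fin by (simp add: K_def)
      ultimately have K: "2 \<le> card (K x)" using card_mono[of "K x" "{x, y}"] xy(3) by simp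
      have "P (K x) \<subseteq> C" using P[OF K] xy(1) C by (auto simp: K_def)
      then show ?thesis using K xy(1) sub[OF C] by blast
    qed
    show "\<not> C \<subseteq> e" if "C \<in> H" "e \<in> ?M" for C e
    proof
      assume "C \<subseteq> e"
      moreover have "card e = 2" using that P by auto
      ultimately have "card C \<le> 2" by (metis card_mono card.infinite zero_neq_numeral)
      then show False using large[OF that(1)] by simp
    qed
  qed (use fin sub in auto)
  then show ?thesis ..
qed

section \<open>Directed cycles\<close>

definition cycle_sets :: "('a, 'b) pre_digraph \<Rightarrow> 'a set set" where
  "cycle_sets G = {tail G ` set p | p. pre_digraph.cycle G p}"

lemma (in wf_digraph) head_of_closed_walk:
  assumes "awalk u p u" and "p \<noteq> []"
  shows "head G ` set p = tail G ` set p"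
proof -
  have "insert w (head G ` set q) = insert v (tail G ` set q)" if "awalk w q v" for w q v
    using that
    by (induction q arbitrary: w) (auto simp: awalk_Cons_iff awalk_Nil_iff)
  moreover have "u \<in> tail G ` set p" using assms by (cases p) (auto simp: awalk_Cons_iff)
  moreover have "u \<in> head G ` set p"
    using assms by (cases p rule: rev_cases) (auto simp: awalk_Cons_iff awalk_Nil_iff)
  ultimately show ?thesis using assms(1) by (metis insert_absorb)
qed

text \<open>
  A property that passes from tails to heads first reaches the end \<^term>\<open>u\<close> of the walk, which is also its
  beginning, and from there all of the walk.
\<close>

lemma (in wf_digraph) invariant_on_closed_walk:
  assumes walk: "awalk u p u" and "v \<in> tail G ` set p" and "Q v"
    and inv: "\<And>a. a \<in> set p \<Longrightarrow> Q (tail G a) \<Longrightarrow> Q (head G a)"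
    and "w \<in> tail G ` set p"
  shows "Q w"
proof -
  have along: "Q y \<and> (\<forall>a\<in>set q. Q (tail G a))"
    if "awalk x q y" "Q x" "set q \<subseteq> set p" for x q y
    using that
  proof (induction q arbitrary: x)
    case (Cons a q)
    then have "Q (head G a)" using inv[of a] by (auto simp: awalk_Cons_iff)
    then show ?case using Cons by (auto simp: awalk_Cons_iff)
  qed (auto simp: awalk_Nil_iff)
  have "Q y" if "awalk x q y" "v \<in> tail G ` set q" "set q \<subseteq> set p" for x q y
    using that
  proof (induction q arbitrary: x)
    case (Cons a q)
    show ?case
    proof (cases "v = tail G a")
      case True
      then have "Q x" using Cons.prems(1) \<open>Q v\<close> by (simp add: awalk_Cons_iff)
      then show ?thesis using along[OF Cons.prems(1) _ Cons.prems(3)] by blast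
    next
      case False
      then show ?thesis
        using Cons.IH[of "head G a"] Cons.prems by (simp add: awalk_Cons_iff)
    qed
  qed simp
  then have "Q u" using walk assms(2) by blast
  then show ?thesis using along[OF walk _ order_refl] assms(5) by blast
qed

lemma (in wf_digraph) cycle_setE:
  assumes "C \<in> cycle_sets G"
  obtains u p where "awalk u p u" "distinct (tl (awalk_verts u p))" "p \<noteq> []"
    "C = tail G ` set p" "C = head G ` set p"
proof -
  obtain p where "cycle p" "C = tail G ` set p" using assms unfolding cycle_sets_def by blast
  moreover then obtain u where "awalk u p u" "distinct (tl (awalk_verts u p))" "p \<noteq> []"
    unfolding cycle_def by blast
  ultimately show thesis using that head_of_closed_walk by metis
qed

lemma (in wf_digraph) cycle_set_subset:
  assumes "C \<in> cycle_sets G"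
  shows "C \<subseteq> verts G"
proof -
  obtain u p where "awalk u p u" "C = tail G ` set p" using assms by (rule cycle_setE)
  then show ?thesis unfolding awalk_def by auto
qed

text \<open>
  The cycle must leave \<^term>\<open>tail G a\<close>, and \<^term>\<open>a\<close> is the only arc by which it can.
\<close>

lemma (in fin_digraph) cycle_set_next:
  assumes "D \<in> cycle_sets G" and "a \<in> arcs G" and "tail G a \<in> D" and "out_degree G (tail G a) \<le> 1"
  shows "head G a \<in> D"
proof -
  obtain u p where p: "awalk u p u" "D = tail G ` set p" "D = head G ` set p"
    using assms(1) by (elim cycle_setE)
  obtain b where b: "b \<in> set p" "tail G b = tail G a" using p(2) assms(3) by auto
  then have "{a, b} \<subseteq> out_arcs G (tail G a)" using assms(2) p(1) by auto
  then have "card {a, b} \<le> 1"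
    using assms(4) card_mono[OF finite_out_arcs] unfolding out_degree_def by (meson order_trans)
  then have "a = b" by (cases "a = b") auto
  then show ?thesis using b p(3) by auto
qed

lemma (in fin_digraph) cycle_set_previous:
  assumes "D \<in> cycle_sets G" and "a \<in> arcs G" and "head G a \<in> D" and "in_degree G (head G a) \<le> 1"
  shows "tail G a \<in> D"
proof -
  obtain u p where p: "awalk u p u" "D = tail G ` set p" "D = head G ` set p"
    using assms(1) by (elim cycle_setE)
  obtain b where b: "b \<in> set p" "head G b = head G a" using p(3) assms(3) by auto
  then have "{a, b} \<subseteq> in_arcs G (head G a)" using assms(2) p(1) by auto
  then have "card {a, b} \<le> 1"
    using assms(4) card_mono[OF finite_in_arcs] unfolding in_degree_def by (meson order_trans)
  then have "a = b" by (cases "a = b") auto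
  then show ?thesis using b p(2) by auto
qed

lemma (in oriented_graph) card_cycle_set:
  assumes "C \<in> cycle_sets G"
  shows "2 < card C"
proof -
  obtain u p where p: "awalk u p u" "distinct (tl (awalk_verts u p))" "p \<noteq> []" "C = head G ` set p"
    using assms by (elim cycle_setE)
  have "awalk_verts w q = w # map (head G) q" if "awalk w q v" for w q v
    using that by (induction q arbitrary: w) (auto simp: awalk_Cons_iff)
  then have "tl (awalk_verts u p) = map (head G) p" using p(1) by simp
  then have card: "card C = length p"
    using p(2,4) by (metis distinct_card length_map list.set_map)
  show ?thesis
  proof (rule ccontr)
    assume "\<not> 2 < card C"
    then consider a where "p = [a]" | a b where "p = [a, b]"
      using card p(3) by (cases p; cases "tl p"; cases "tl (tl p)") auto
    then show False
    proof cases
      case 1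
      then have "a \<in> arcs G" "tail G a = head G a"
        using p(1) by (auto simp: awalk_Cons_iff awalk_Nil_iff)
      then show False using no_loops by blast
    next
      case 2
      then have "a \<in> arcs G" "b \<in> arcs G" "tail G a = head G b" "tail G b = head G a"
        using p(1) by (auto simp: awalk_Cons_iff awalk_Nil_iff)
      then have "tail G a \<rightarrow> head G a" "head G a \<rightarrow> tail G a"
        using in_arcs_imp_in_arcs_ends[of a] in_arcs_imp_in_arcs_ends[of b] by auto
      then show False using no_opposite_arcs by blast
    qed
  qed
qed

text \<open>
  If some arc of the cycle leads from a vertex of out-degree one to a vertex of in-degree one, its
  ends are twins. Otherwise the head of an arc whose tail has out-degree at most one has in-degree
  at least two and hence out-degree at most one as well. So out-degree at most one propagates along
  the cycle, and holds for all of its vertices or for none; in the latter case all in-degrees are at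
  most one. In both cases every directed cycle that meets this cycle contains all of it, so any two
  of its vertices are twins.
\<close>

lemma (in oriented_graph) cycle_set_contains_twins:
  assumes deg: "Delta_min G \<le> 1" and C: "C \<in> cycle_sets G"
  shows "\<exists>x\<in>C. \<exists>y\<in>C. x \<noteq> y \<and> (\<forall>D\<in>cycle_sets G. x \<in> D \<longleftrightarrow> y \<in> D)"
proof -
  obtain u p where p: "awalk u p u" "p \<noteq> []" "C = tail G ` set p" "C = head G ` set p"
    using C by (elim cycle_setE)
  have arcs: "a \<in> arcs G" if "a \<in> set p" for a using p(1) that by auto
  have low: "out_degree G v \<le> 1 \<or> in_degree G v \<le> 1" if "v \<in> verts G" for v
  proof -
    have "min (out_degree G v) (in_degree G v) \<le> Delta_min G"
      unfolding Delta_min_def using that by (intro cSUP_upper) auto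
    then show ?thesis using deg by linarith
  qed
  obtain a0 where a0: "a0 \<in> set p" using p(2) by (cases p) auto
  have a0C: "tail G a0 \<in> C" "head G a0 \<in> C" "tail G a0 \<noteq> head G a0"
    using a0 p(3,4) no_loops arcs by auto
  consider (link) a where "a \<in> set p" "out_degree G (tail G a) \<le> 1" "in_degree G (head G a) \<le> 1"
    | (out) "\<And>v. v \<in> C \<Longrightarrow> out_degree G v \<le> 1"
    | (inn) "\<And>v. v \<in> C \<Longrightarrow> in_degree G v \<le> 1"
  proof (cases "\<exists>v\<in>C. out_degree G v \<le> 1")
    case False
    then show ?thesis using inn low cycle_set_subset[OF C] by blast
  next
    case True
    then obtain v where v: "v \<in> C" "out_degree G v \<le> 1" by blast
    show ?thesis
    proof (cases "\<exists>a\<in>set p. out_degree G (tail G a) \<le> 1 \<and> in_degree G (head G a) \<le> 1")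
      case True
      then show ?thesis using link by blast
    next
      case False
      then have "out_degree G (head G a) \<le> 1" if "a \<in> set p" "out_degree G (tail G a) \<le> 1" for a
        using that low[of "head G a"] arcs[OF that(1)] by auto
      then have "out_degree G w \<le> 1" if "w \<in> C" for w
        using invariant_on_closed_walk[OF p(1), of v "\<lambda>v. out_degree G v \<le> 1" w] v that p(3) by auto
      then show ?thesis using out by blast
    qed
  qed
  then show ?thesis
  proof cases
    case link
    then have "tail G a \<in> D \<longleftrightarrow> head G a \<in> D" if "D \<in> cycle_sets G" for D
      using cycle_set_next[OF that arcs] cycle_set_previous[OF that arcs] by blast
    moreover have "tail G a \<in> C" "head G a \<in> C" using link(1) p(3,4) by blast+
    moreover have "tail G a \<noteq> head G a" using link(1) no_loops arcs by blast
    ultimately show ?thesis by (intro bexI conjI ballI)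
  next
    case out
    have "y \<in> D" if D: "D \<in> cycle_sets G" and xy: "x \<in> C" "y \<in> C" "x \<in> D" for D x y
    proof -
      have "head G a \<in> D" if a: "a \<in> set p" "tail G a \<in> D" for a
        using cycle_set_next[OF D arcs[OF a(1)] a(2)] out[of "tail G a"] a p(3) by blast
      then show ?thesis
        using invariant_on_closed_walk[OF p(1), of x "\<lambda>v. v \<in> D" y] xy unfolding p(3) by blast
    qed
    then have "tail G a0 \<in> D \<longleftrightarrow> head G a0 \<in> D" if "D \<in> cycle_sets G" for D
      using that a0C(1,2) by blast
    then show ?thesis using a0C by (intro bexI conjI ballI)
  next
    case inn
    have "y \<in> D" if D: "D \<in> cycle_sets G" and xy: "x \<in> C" "y \<in> C" "x \<in> D" for D x y
    proof (rule ccontr)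
      assume "y \<notin> D"
      have "head G a \<notin> D" if a: "a \<in> set p" "tail G a \<notin> D" for a
        using cycle_set_previous[OF D arcs[OF a(1)]] inn[of "head G a"] a p(4) by blast
      then have "x \<notin> D"
        using invariant_on_closed_walk[OF p(1), of y "\<lambda>v. v \<notin> D" x] \<open>y \<notin> D\<close> xy(1,2)
        unfolding p(3) by blast
      then show False using xy(3) by simp
    qed
    then have "tail G a0 \<in> D \<longleftrightarrow> head G a0 \<in> D" if "D \<in> cycle_sets G" for D
      using that a0C(1,2) by blast
    then show ?thesis using a0C by (intro bexI conjI ballI)
  qed
qed

lemma (in wf_digraph) cycle_induce_subgraph_iff:
  assumes "S \<subseteq> verts G"
  shows "pre_digraph.cycle (G \<restriction> S) p \<longleftrightarrow> cycle p \<and> tail G ` set p \<subseteq> S"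
proof -
  interpret S: wf_digraph "G \<restriction> S" by (rule wellformed_induce_subgraph)
  have cas: "S.cas u q v = cas u q v" for u q v
    by (induction q arbitrary: u) (auto simp: S.cas.simps)
  have verts: "S.awalk_verts u q = awalk_verts u q" for u q
    by (induction q arbitrary: u) (auto simp: S.awalk_verts.simps)
  show ?thesis
  proof (intro iffI conjI)
    assume "S.cycle p"
    then obtain u where u: "S.awalk u p u" "distinct (tl (awalk_verts u p))" "p \<noteq> []"
      by (auto simp: S.cycle_def verts)
    then have "awalk u p u" using assms by (auto simp: S.awalk_def awalk_def cas)
    then show "cycle p" using u(2,3) by (auto simp: cycle_def)
    show "tail G ` set p \<subseteq> S" using u(1) by (auto simp: S.awalk_def)
  next
    assume "cycle p \<and> tail G ` set p \<subseteq> S"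
    then obtain u where u: "awalk u p u" "distinct (tl (awalk_verts u p))" "p \<noteq> []"
      and sub: "tail G ` set p \<subseteq> S" by (auto simp: cycle_def)
    have "head G ` set p \<subseteq> S" using head_of_closed_walk[OF u(1,3)] sub by simp
    moreover have "u \<in> S" using u(1,3) sub by (cases p) (auto simp: awalk_Cons_iff)
    ultimately have "S.awalk u p u" using u(1) sub by (auto simp: S.awalk_def awalk_def cas)
    then show "S.cycle p" using u(2,3) by (auto simp: S.cycle_def verts)
  qed
qed

lemma (in wf_digraph) dicolouring_iff:
  "dicolouring k G c \<longleftrightarrow> c \<in> verts G \<rightarrow>\<^sub>E {1..k} \<and> (\<forall>C\<in>cycle_sets G. \<not> monochromatic c C)"
proof -
  have "(\<exists>i\<in>{1..k}. \<exists>p. pre_digraph.cycle (G \<restriction> {v \<in> verts G. c v = i}) p) \<longleftrightarrow>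
    (\<exists>C\<in>cycle_sets G. monochromatic c C)" if c: "c \<in> verts G \<rightarrow>\<^sub>E {1..k}"
  proof
    assume "\<exists>i\<in>{1..k}. \<exists>p. pre_digraph.cycle (G \<restriction> {v \<in> verts G. c v = i}) p"
    then obtain i p where "pre_digraph.cycle (G \<restriction> {v \<in> verts G. c v = i}) p" by blast
    then have "cycle p" "tail G ` set p \<subseteq> {v \<in> verts G. c v = i}"
      using cycle_induce_subgraph_iff[of "{v \<in> verts G. c v = i}" p] by auto
    then have "tail G ` set p \<in> cycle_sets G" "monochromatic c (tail G ` set p)"
      by (auto simp: cycle_sets_def monochromatic_def)
    then show "\<exists>C\<in>cycle_sets G. monochromatic c C" ..
  next
    assume "\<exists>C\<in>cycle_sets G. monochromatic c C"
    then obtain C where C: "C \<in> cycle_sets G" and mono: "monochromatic c C" ..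
    obtain p where p: "cycle p" "C = tail G ` set p" using C unfolding cycle_sets_def by blast
    have sub: "C \<subseteq> verts G" using cycle_set_subset[OF C] .
    moreover have "C \<noteq> {}" using p by (auto simp: cycle_def)
    ultimately obtain u where u: "u \<in> C" "u \<in> verts G" by blast
    have "tail G ` set p \<subseteq> {v \<in> verts G. c v = c u}"
      using sub mono u(1) unfolding p(2) monochromatic_def by blast
    then have "pre_digraph.cycle (G \<restriction> {v \<in> verts G. c v = c u}) p"
      using p(1) cycle_induce_subgraph_iff[of "{v \<in> verts G. c v = c u}" p] by blast
    moreover have "c u \<in> {1..k}" using c u(2) by (auto simp: PiE_iff)
    ultimately show "\<exists>i\<in>{1..k}. \<exists>p. pre_digraph.cycle (G \<restriction> {v \<in> verts G. c v = i}) p" by blast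
  qed
  then show ?thesis
    unfolding dicolouring_def bex_simps(8)[symmetric] by (intro conj_cong) simp_all
qed

section \<open>Walks in the dicolouring graph\<close>

lemma (in graph) reverse_awalk:
  assumes "awalk u p v"
  shows "\<exists>q. awalk v q u \<and> length q = length p"
  using assms
proof (induction p arbitrary: u)
  case Nil
  then show ?case by (intro exI[of _ "[]"]) (auto simp: awalk_Nil_iff)
next
  case (Cons a p)
  then obtain q where q: "awalk v q (head G a)" "length q = length p"
    by (auto simp: awalk_Cons_iff)
  have a: "a \<in> arcs G" "tail G a = u" using Cons.prems by (auto simp: awalk_Cons_iff)
  then have "u \<rightarrow> head G a" using in_arcs_imp_in_arcs_ends[of a] by simp
  then have "head G a \<rightarrow> u" using sym_arcs by (auto simp: symmetric_def sym_def)
  then obtain b where "b \<in> arcs G" "tail G b = head G a" "head G b = u" by auto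
  then have "awalk v (q @ [b]) u"
    using q(1) by (intro awalk_appendI[OF q(1)]) (auto simp: awalk_Cons_iff awalk_Nil_iff)
  then show ?case using q(2) by (intro exI[of _ "q @ [b]"]) simp
qed

lemma verts_dicolouring_graph: "verts (dicolouring_graph k G) = {c. dicolouring k G c}"
  by (simp add: dicolouring_graph_def)

lemma arcs_dicolouring_graph:
  "arcs (dicolouring_graph k G) = {(c, d). dicolouring k G c \<and> dicolouring k G d \<and>
    (\<exists>v. disagreement (verts G) c d = {v})}"
proof -
  have "(\<exists>!v. v \<in> verts G \<and> c v \<noteq> d v) \<longleftrightarrow> (\<exists>v. disagreement (verts G) c d = {v})" for c d :: "'a \<Rightarrow> nat"
    unfolding disagreement_def Ex1_def by blast
  then show ?thesis by (simp add: dicolouring_graph_def)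
qed

lemma tail_head_dicolouring_graph:
  "tail (dicolouring_graph k G) = fst" "head (dicolouring_graph k G) = snd"
  by (simp_all add: dicolouring_graph_def)

lemmas dicolouring_graph_simps =
  verts_dicolouring_graph arcs_dicolouring_graph tail_head_dicolouring_graph

text \<open>
  An arc of the dicolouring graph changes a single vertex, so the number of vertices on which two
  dicolourings differ is a lower bound for their distance.
\<close>

lemma (in fin_digraph) disagreement_le_length:
  assumes "pre_digraph.awalk (dicolouring_graph k G) c p d"
  shows "card (disagreement (verts G) c d) \<le> length p"
proof -
  interpret D: graph "dicolouring_graph k G" by (rule graph_dicolouring_graph)
  show ?thesis using assms
  proof (induction p arbitrary: c)
    case Nil
    then show ?case by (simp add: D.awalk_Nil_iff disagreement_def)
  next
    case (Cons a p)
    have a: "a \<in> arcs (dicolouring_graph k G)" "c = fst a" and p: "D.awalk (snd a) p d"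
      using Cons.prems by (auto simp: D.awalk_Cons_iff dicolouring_graph_simps)
    obtain v where v: "disagreement (verts G) c (snd a) = {v}"
      using a by (cases a) (auto simp: dicolouring_graph_simps)
    have "disagreement (verts G) c d \<subseteq> insert v (disagreement (verts G) (snd a) d)"
    proof
      fix x assume "x \<in> disagreement (verts G) c d"
      moreover have "x \<notin> disagreement (verts G) c (snd a)" if "x \<noteq> v" using that v by blast
      ultimately show "x \<in> insert v (disagreement (verts G) (snd a) d)"
        by (cases "x = v") (auto simp: disagreement_def)
    qed
    moreover have "finite (disagreement (verts G) (snd a) d)" by (simp add: disagreement_def)
    ultimately have "card (disagreement (verts G) c d) \<le> card (insert v (disagreement (verts G) (snd a) d))"
      by (intro card_mono) auto
    also have "\<dots> \<le> Suc (card (disagreement (verts G) (snd a) d))" by (simp add: card_insert_if disagreement_def)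
    finally show ?case using Cons.IH[OF p] by simp
  qed
qed

text \<open>
  The lower bound is attained as soon as some vertex of disagreement can always be given its target
  colour.
\<close>

lemma (in fin_digraph) monotone_recolouring_walk:
  assumes "dicolouring k G c" and d: "dicolouring k G d"
    and step: "\<And>c. dicolouring k G c \<Longrightarrow> disagreement (verts G) c d \<noteq> {} \<Longrightarrow>
      \<exists>v\<in>disagreement (verts G) c d. dicolouring k G (c(v := d v))"
  shows "\<exists>p. pre_digraph.awalk (dicolouring_graph k G) c p d \<and>
    length p = card (disagreement (verts G) c d)"
proof -
  interpret D: graph "dicolouring_graph k G" by (rule graph_dicolouring_graph)
  have fin: "finite (disagreement (verts G) c d)" for c by (simp add: disagreement_def)
  show ?thesis using assms(1)
  proof (induction "card (disagreement (verts G) c d)" arbitrary: c)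
    case 0
    then have "disagreement (verts G) c d = {}" using fin[of c] by simp
    then have "\<forall>v\<in>verts G. c v = d v" by (auto simp: disagreement_def)
    then have "c = d"
      using \<open>dicolouring k G c\<close> d unfolding dicolouring_def by (elim conjE) (rule PiE_ext, auto)
    then show ?case using d
      by (intro exI[of _ "[]"]) (simp add: D.awalk_Nil_iff dicolouring_graph_simps disagreement_def)
  next
    case (Suc m)
    then have "disagreement (verts G) c d \<noteq> {}" by auto
    then obtain v where v: "v \<in> disagreement (verts G) c d" and dic: "dicolouring k G (c(v := d v))"
      using step Suc.prems by blast
    have "disagreement (verts G) (c(v := d v)) d = disagreement (verts G) c d - {v}"
      by (auto simp: disagreement_def)
    then have m: "m = card (disagreement (verts G) (c(v := d v)) d)"
      using Suc.hyps(2) v fin[of c] by simp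
    obtain p where p: "D.awalk (c(v := d v)) p d" "length p = m"
      using Suc.hyps(1)[OF m dic] m by blast
    have "disagreement (verts G) c (c(v := d v)) = {v}" using v by (auto simp: disagreement_def)
    then have "D.awalk c ((c, c(v := d v)) # p) d"
      using p(1) dic Suc.prems by (simp add: D.awalk_Cons_iff dicolouring_graph_simps)
    then show ?case using p(2) Suc.hyps(2) by (metis length_Cons)
  qed
qed

lemma (in fin_digraph) swap_colours:
  assumes "dicolouring 2 G c"
  shows "dicolouring 2 G (\<lambda>v\<in>verts G. 3 - c v)"
    and "disagreement (verts G) c (\<lambda>v\<in>verts G. 3 - c v) = verts G"
proof -
  have c: "c v = 1 \<or> c v = 2" if "v \<in> verts G" for v
    using assms that by (force simp: dicolouring_def PiE_iff)
  have "\<not> monochromatic (\<lambda>v\<in>verts G. 3 - c v) C" if C: "C \<in> cycle_sets G" for C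
  proof
    assume mono: "monochromatic (\<lambda>v\<in>verts G. 3 - c v) C"
    have "c x = c y" if "x \<in> C" "y \<in> C" for x y
    proof -
      have V: "x \<in> verts G" "y \<in> verts G" using that cycle_set_subset[OF C] by auto
      have "(\<lambda>v\<in>verts G. 3 - c v) x = (\<lambda>v\<in>verts G. 3 - c v) y"
        using mono that unfolding monochromatic_def by blast
      then have "3 - c x = 3 - c y" using V by simp
      then show ?thesis using c[OF V(1)] c[OF V(2)] by auto
    qed
    then have "monochromatic c C" unfolding monochromatic_def by blast
    then show False using assms C by (simp add: dicolouring_iff)
  qed
  moreover have "3 - c v \<in> {1..2}" if "v \<in> verts G" for v using c[OF that] by auto
  ultimately show "dicolouring 2 G (\<lambda>v\<in>verts G. 3 - c v)" by (auto simp: dicolouring_iff)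
  have "c v \<noteq> 3 - c v" if "v \<in> verts G" for v using c[OF that] by auto
  then show "disagreement (verts G) c (\<lambda>v\<in>verts G. 3 - c v) = verts G"
    by (auto simp: disagreement_def)
qed

lemma (in oriented_graph) exists_short_recolouring:
  assumes "Delta_min G \<le> 1"
  shows "\<exists>c. dicolouring 2 G c"
    and "dicolouring 2 G a \<Longrightarrow> dicolouring 2 G b \<Longrightarrow>
      \<exists>p. pre_digraph.awalk (dicolouring_graph 2 G) a p b \<and> length p \<le> card (verts G)"
proof -
  interpret D: graph "dicolouring_graph 2 G" by (rule graph_dicolouring_graph)
  obtain M where "paired_hypergraph (verts G) (cycle_sets G) M"
    using ex_paired_hypergraph[of "verts G" "cycle_sets G"] finite_verts cycle_set_subset
      card_cycle_set cycle_set_contains_twins[OF assms] by blast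
  then interpret P: paired_hypergraph "verts G" "cycle_sets G" M .
  have proper: "P.proper c \<longleftrightarrow> dicolouring 2 G c" for c
    by (simp add: P.proper_def dicolouring_iff)
  then show "\<exists>c. dicolouring 2 G c" using P.exists_proper by simp
  assume a: "dicolouring 2 G a" and b: "dicolouring 2 G b"
  then have "a \<in> verts G \<rightarrow>\<^sub>E {1..2}" "b \<in> verts G \<rightarrow>\<^sub>E {1..2}" by (auto simp: dicolouring_def)
  then obtain c i where c: "P.separating c" "\<forall>v\<in>verts G - \<Union>M. c v = i"
    and len: "card (disagreement (verts G) a c) + card (disagreement (verts G) c b) \<le> card (verts G)"
    by (rule P.exists_meeting_point)
  have to_c: "\<exists>p. D.awalk x p c \<and> length p = card (disagreement (verts G) x c)"
    if "dicolouring 2 G x" for x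
    using that P.separating_imp_proper[OF c(1)] P.exists_recolouring_towards[OF _ c]
    unfolding proper by (rule monotone_recolouring_walk)
  obtain p where p: "D.awalk a p c" "length p = card (disagreement (verts G) a c)"
    using to_c[OF a] by blast
  obtain q where q: "D.awalk b q c" "length q = card (disagreement (verts G) b c)"
    using to_c[OF b] by blast
  obtain r where r: "D.awalk c r b" "length r = length q" using D.reverse_awalk[OF q(1)] by blast
  have "disagreement (verts G) b c = disagreement (verts G) c b" by (auto simp: disagreement_def)
  then have "length (p @ r) \<le> card (verts G)" using p(2) q(2) r(2) len by simp
  then show "\<exists>p. D.awalk a p b \<and> length p \<le> card (verts G)"
    using D.awalk_appendI[OF p(1) r(1)] by blast
qed

theorem theorem9:
  fixes G :: "('a, 'b) pre_digraph" and n :: nat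
  assumes "oriented_graph G"
    and "card (verts G) = n"
    and "Delta_min G \<le> 1"
  shows "Digraph_Component.connected (dicolouring_graph 2 G) \<and>
    graph_diameter (dicolouring_graph 2 G) = ereal (real n)"
proof -
  interpret oriented_graph G by (rule assms(1))
  let ?D = "dicolouring_graph 2 G"
  interpret D: graph ?D by (rule graph_dicolouring_graph)
  have short: "\<exists>p. D.awalk a p b \<and> length p \<le> n" if "a \<in> verts ?D" "b \<in> verts ?D" for a b
    using exists_short_recolouring(2)[OF assms(3)] that assms(2) by (simp add: verts_dicolouring_graph)
  obtain c where c: "dicolouring 2 G c" using exists_short_recolouring(1)[OF assms(3)] by blast
  define c' where "c' = (\<lambda>v\<in>verts G. 3 - c v)"
  have V: "c \<in> verts ?D" "c' \<in> verts ?D"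
    using c swap_colours(1)[OF c] by (auto simp: verts_dicolouring_graph c'_def)
  have "strongly_connected ?D"
    unfolding strongly_connected_def using V(1) short D.reachable_awalk by blast
  then have "Digraph_Component.connected ?D" by (intro D.connectedI) (use V(1) in \<open>auto simp: strongly_connected_def intro: D.reachable_mk_symmetricI\<close>)
  moreover have "graph_diameter ?D = ereal (real n)"
  proof (rule antisym)
    have "D.\<mu> (\<lambda>_. 1) a b \<le> ereal (real n)" if ab: "a \<in> verts ?D" "b \<in> verts ?D" for a b
    proof -
      obtain p where "D.awalk a p b" "length p \<le> n" using short[OF ab] by blast
      then show ?thesis unfolding D.\<mu>_unit_weights by (intro INF_lower2[of p]) auto
    qed
    then show "graph_diameter ?D \<le> ereal (real n)"
      unfolding graph_diameter_def by (intro SUP_least)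
    have "n \<le> length p" if "D.awalk c p c'" for p
      using disagreement_le_length[OF that] swap_colours(2)[OF c] assms(2) by (simp add: c'_def)
    then have "ereal (real n) \<le> D.\<mu> (\<lambda>_. 1) c c'"
      unfolding D.\<mu>_unit_weights by (intro INF_greatest) auto
    then show "ereal (real n) \<le> graph_diameter ?D"
      unfolding graph_diameter_def by (intro SUP_upper2[OF V(1)] SUP_upper2[OF V(2)])
  qed
  ultimately show ?thesis ..
qed

end
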